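(* Let $k$ be a positive integer. Then $(k+\sqrt{k^2+4})/2$ belongs to the $(2k-1)$-th derived set of $S_{\operatorname{graph}}$, and $k+1$ belongs to the $(2k)$-th derived set of $S_{\operatorname{graph}}$.
   Context: Graphs are finite simple graphs; eigenvalues are those of the adjacency matrix. A graph $G$ is a Salem graph if either it is nonbipartite, has exactly one eigenvalue $\lambda>2$ and none in $(-\infty,-2)$; or it is bipartite, has exactly one eigenvalue $\lambda>2$ and only $-\lambda$ in $(-\infty,-2)$. It is trivial if nonbipartite with $\lambda\in\mathbb Z$ or bipartite with $\lambda^2\in\mathbb Z$. For nontrivial $G$, $\tau(G)$ is the larger root of $z+1/z=\lambda$ (nonbipartite) or of $\sqrt z+1/\sqrt z=\lambda$ (bipartite). $T_{\operatorname{graph}}$ is the set of all such $\tau(G)$, and $S_{\operatorname{graph}}$ is the set of limit points of $T_{\operatorname{graph}}$ (a set of Pisot numbers). The first derived set of a real set is its set of limit points; for $j\ge2$ the $j$-th derived set is the set of limit points of the $(j-1)$-th derived set. *)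

theory Defs
  imports "Jordan_Normal_Form.Char_Poly" "HOL-Analysis.Analysis"
begin

definition simple_graph :: "nat \<Rightarrow> (nat \<Rightarrow> nat \<Rightarrow> bool) \<Rightarrow> bool" where
  "simple_graph n E \<longleftrightarrow> (\<forall>i<n. \<forall>j<n. E i j \<longleftrightarrow> E j i) \<and> (\<forall>i<n. \<not> E i i)"

definition adj_mat :: "nat \<Rightarrow> (nat \<Rightarrow> nat \<Rightarrow> bool) \<Rightarrow> real Matrix.mat" where
  "adj_mat n E = Matrix.mat n n (\<lambda>(i, j). if E i j then 1 else 0)"

definition eig_count :: "nat \<Rightarrow> (nat \<Rightarrow> nat \<Rightarrow> bool) \<Rightarrow> real set \<Rightarrow> nat" where
  "eig_count n E S =
     (\<Sum>x\<in>{x. poly (char_poly (adj_mat n E)) x = 0 \<and> x \<in> S}. order x (char_poly (adj_mat n E)))"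

definition is_eigenvalue :: "nat \<Rightarrow> (nat \<Rightarrow> nat \<Rightarrow> bool) \<Rightarrow> real \<Rightarrow> bool" where
  "is_eigenvalue n E x \<longleftrightarrow> poly (char_poly (adj_mat n E)) x = 0"

definition bipartite :: "nat \<Rightarrow> (nat \<Rightarrow> nat \<Rightarrow> bool) \<Rightarrow> bool" where
  "bipartite n E \<longleftrightarrow> (\<exists>c :: nat \<Rightarrow> bool. \<forall>i<n. \<forall>j<n. E i j \<longrightarrow> c i \<noteq> c j)"

definition salem_graph :: "nat \<Rightarrow> (nat \<Rightarrow> nat \<Rightarrow> bool) \<Rightarrow> real \<Rightarrow> bool" where
  "salem_graph n E lam \<longleftrightarrow>
     lam > 2 \<and> is_eigenvalue n E lam \<and> eig_count n E {2<..} = 1 \<and>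
     (if bipartite n E
      then is_eigenvalue n E (- lam) \<and> eig_count n E {..< -2} = 1
      else eig_count n E {..< -2} = 0)"

definition trivial_salem :: "nat \<Rightarrow> (nat \<Rightarrow> nat \<Rightarrow> bool) \<Rightarrow> real \<Rightarrow> bool" where
  "trivial_salem n E lam \<longleftrightarrow>
     (if bipartite n E then lam ^ 2 \<in> \<int> else lam \<in> \<int>)"

text \<open>tau: larger root of z + 1/z = lam (nonbipartite) or of sqrt z + 1/sqrt z = lam (bipartite).\<close>
definition tau :: "nat \<Rightarrow> (nat \<Rightarrow> nat \<Rightarrow> bool) \<Rightarrow> real \<Rightarrow> real" where
  "tau n E lam =
     (if bipartite n E then ((lam + sqrt (lam ^ 2 - 4)) / 2) ^ 2
      else (lam + sqrt (lam ^ 2 - 4)) / 2)"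

definition T_graph :: "real set" where
  "T_graph = {tau n E lam | n E lam.
      simple_graph n E \<and> salem_graph n E lam \<and> \<not> trivial_salem n E lam}"

definition S_graph :: "real set" where
  "S_graph = {x. x islimpt T_graph}"

fun derived_set :: "nat \<Rightarrow> real set \<Rightarrow> real set" where
  "derived_set 0 A = A"
| "derived_set (Suc j) A = {x. x islimpt derived_set j A}"

end

theory Submission
  imports Defs
begin

text \<open>Take a tree consisting of a root, \<open>k\<close> neighbours of the root each carrying two paths, and \<open>r\<close> further
  paths hanging at the root. Gaussian elimination from the leaves writes its characteristic polynomial,
  for arguments above 2, as a product of pivots. All pivots but the root's are positive, and the root's
  pivot has slope at least 1, so there is exactly one eigenvalue above 2 and it is simple. This
  eigenvalue strictly increases with each of the \<open>2k + r\<close> path lengths. Letting these lengths tend to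
  infinity one after the other thus gives an iterated limit point. (Only finitely many values of
  \<open>\<lambda>\<^sup>2\<close> in a bounded range are integers, so triviality is avoided.) In terms of \<open>z = \<tau>\<close> the limit satisfies
  \<open>z + 1 = k z / (z - 1) + r\<close>: for \<open>r = 0\<close> this gives \<open>(k + sqrt (k\<^sup>2 + 4)) / 2\<close>, and for \<open>r = 1\<close> it
  gives \<open>k + 1\<close>.\<close>

section \<open>Characteristic polynomials of forests\<close>

lemma det_upper_triangular_prod:
  fixes f :: "nat \<Rightarrow> nat \<Rightarrow> 'a::comm_ring_1"
  assumes "\<And>i j. j < i \<Longrightarrow> i < n \<Longrightarrow> f i j = 0"
  shows "Determinant.det (Matrix.mat n n (\<lambda>(i, j). f i j)) = (\<Prod>i<n. f i i)"
proof -
  have "upper_triangular (Matrix.mat n n (\<lambda>(i, j). f i j))"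
    using assms by (auto intro!: upper_triangularI)
  then show ?thesis
    by (subst det_upper_triangular) (auto simp: prod_list_diag_prod atLeast0LessThan)
qed

lemma poly_char_poly_adj_mat:
  "poly (char_poly (adj_mat n E)) x =
     Determinant.det (Matrix.mat n n (\<lambda>(i, j). (if i = j then x else 0) - of_bool (E i j)))"
  unfolding char_poly_def
  by (rule poly_det_cong[of _ n]) (auto simp: char_poly_matrix_def adj_mat_def)

text \<open>Gaussian elimination from the leaves towards the roots: \<open>xI - A\<close> factors as \<open>B U\<^sup>T\<close> with
  \<open>B\<close>, \<open>U\<close> upper triangular, and the pivots are the \<open>d i\<close>.\<close>

lemma char_poly_ordered_forest:
  fixes d :: "nat \<Rightarrow> real"
  assumes less: "\<And>i j. P i j \<Longrightarrow> j < i"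
    and unique: "\<And>i j j'. P i j \<Longrightarrow> P i j' \<Longrightarrow> j = j'"
    and nz: "\<And>i j. i < n \<Longrightarrow> P i j \<Longrightarrow> d i \<noteq> 0"
    and d: "\<And>i. i < n \<Longrightarrow> d i = x - (\<Sum>k<n. if P k i then 1 / d k else 0)"
    and E: "\<And>i j. i < n \<Longrightarrow> j < n \<Longrightarrow> E i j \<longleftrightarrow> P i j \<or> P j i"
  shows "poly (char_poly (adj_mat n E)) x = (\<Prod>i<n. d i)"
proof -
  define b where "b i k = (if i = k then d k else 0) - of_bool (P k i)" for i k
  define u where "u i k = (if i = k then 1 else 0) - (if P k i then 1 / d k else 0)" for i k
  let ?B = "Matrix.mat n n (\<lambda>(i, k). b i k)" and ?U = "Matrix.mat n n (\<lambda>(i, k). u i k)"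
  have irrefl: "\<not> P i i" for i
    using less by blast
  have "(if i = j then x else 0) - of_bool (E i j) = (\<Sum>k<n. b i k * u j k)"
    if "i < n" "j < n" for i j
  proof -
    \<comment> \<open>A summand survives only if \<open>k = i\<close>, \<open>k = j\<close>, or
      \<open>k\<close> is a child of both \<open>i\<close> and \<open>j\<close>. In the last case
      \<open>unique\<close> forces \<open>i = j\<close>, so off the diagonal only the two edge terms
      remain.\<close>
    have expand: "b i k * u j k = (if k = i then (if i = j then d i else 0) - of_bool (P i j) else 0)
        - (if k = j then of_bool (P j i) else 0)
        + (if P k i \<and> i = j then 1 / d k else 0)" if "k < n" for k
      using nz[OF that] irrefl unique[of k i j] that by (auto simp: b_def u_def)
    have "(\<Sum>k<n. b i k * u j k) = ((if i = j then d i else 0) - of_bool (P i j))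
        - of_bool (P j i) + (\<Sum>k<n. if P k i \<and> i = j then 1 / d k else 0)"
      using that by (simp add: expand sum.distrib sum_subtractf)
    also have "\<dots> = (if i = j then x else 0) - of_bool (E i j)"
      using that d[of i] E[of i j] irrefl less[of i j] less[of j i] by (cases "i = j") auto
    finally show ?thesis ..
  qed
  then have "Matrix.mat n n (\<lambda>(i, j). (if i = j then x else 0) - of_bool (E i j))
      = ?B * Matrix.transpose_mat ?U"
    by (intro eq_matI) (auto simp: scalar_prod_def atLeast0LessThan)
  then have "poly (char_poly (adj_mat n E)) x = Determinant.det ?B * Determinant.det ?U"
    by (simp add: poly_char_poly_adj_mat det_mult[of _ n] Determinant.det_transpose[of _ n])
  also have "\<dots> = (\<Prod>i<n. b i i) * (\<Prod>i<n. u i i)"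
  proof -
    have "b i j = 0" "u i j = 0" if "j < i" for i j
      using less[of j i] that by (auto simp: b_def u_def)
    then show ?thesis
      by (simp add: det_upper_triangular_prod)
  qed
  also have "\<dots> = (\<Prod>i<n. d i)"
    using irrefl by (simp add: b_def u_def)
  finally show ?thesis .
qed

text \<open>Listing the vertices by increasing \<open>h\<close> puts every parent before its
  children, as the elimination requires, and the parity of \<open>h\<close> is a 2-colouring. The
  graph is fixed before \<open>d\<close> and \<open>x\<close>, so one graph serves all arguments of
  its characteristic polynomial.\<close>

lemma forest_graph_exists:
  fixes V :: "'a set" and par :: "'a \<Rightarrow> 'a option" and h :: "'a \<Rightarrow> nat"
  assumes "finite V" and h: "\<And>c v. par c = Some v \<Longrightarrow> h c = Suc (h v)"
  obtains n E where "simple_graph n E" "bipartite n E"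
    "\<And>d x. (\<And>c v. c \<in> V \<Longrightarrow> par c = Some v \<Longrightarrow> d c \<noteq> 0) \<Longrightarrow>
      (\<And>v. v \<in> V \<Longrightarrow> d v = x - (\<Sum>c\<in>V. if par c = Some v then 1 / d c else 0)) \<Longrightarrow>
      poly (char_poly (adj_mat n E)) x = (\<Prod>v\<in>V. d v)"
proof -
  obtain l where "set l = V" "distinct l"
    using finite_distinct_list[OF \<open>finite V\<close>] by blast
  define vs where "vs = sort_key h l"
  have vs: "set vs = V" "distinct vs" "sorted (map h vs)"
    using \<open>set l = V\<close> \<open>distinct l\<close> by (auto simp: vs_def)
  define n where "n = length vs"
  define P where "P i j \<longleftrightarrow> i < n \<and> j < n \<and> par (vs ! i) = Some (vs ! j)" for i j
  define E where "E i j \<longleftrightarrow> P i j \<or> P j i" for i j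
  have bij: "bij_betw ((!) vs) {..<n} V"
    using vs by (simp add: bij_betw_nth n_def)
  have less: "j < i" if "P i j" for i j
  proof (rule ccontr)
    assume "\<not> j < i"
    then have "h (vs ! i) \<le> h (vs ! j)"
      using sorted_nth_mono[OF vs(3), of i j] that by (simp add: P_def n_def)
    with h that show False
      by (fastforce simp: P_def)
  qed
  show thesis
  proof
    show "simple_graph n E"
      using less by (auto simp: simple_graph_def E_def)
    show "bipartite n E"
      unfolding bipartite_def
      by (rule exI[of _ "\<lambda>i. even (h (vs ! i))"]) (auto simp: E_def P_def dest: h)
    fix d x
    assume nz: "\<And>c v. c \<in> V \<Longrightarrow> par c = Some v \<Longrightarrow> d c \<noteq> (0::real)"
      and d: "\<And>v. v \<in> V \<Longrightarrow> d v = x - (\<Sum>c\<in>V. if par c = Some v then 1 / d c else 0)"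
    have "poly (char_poly (adj_mat n E)) x = (\<Prod>i<n. d (vs ! i))"
    proof (rule char_poly_ordered_forest[where P = P])
      show "i = i'" if "P k i" "P k i'" for k i i'
        using that vs(2) by (auto simp: P_def n_def nth_eq_iff_index_eq)
      show "d (vs ! i) \<noteq> 0" if "P i j" for i j
        using that nz vs(1) by (auto simp: P_def n_def)
      show "d (vs ! i) = x - (\<Sum>k<n. if P k i then 1 / d (vs ! k) else 0)" if "i < n" for i
      proof -
        have "(\<Sum>k<n. if P k i then 1 / d (vs ! k) else 0)
            = (\<Sum>k<n. if par (vs ! k) = Some (vs ! i) then 1 / d (vs ! k) else 0)"
          using that by (intro sum.cong) (auto simp: P_def)
        also have "\<dots> = (\<Sum>c\<in>V. if par c = Some (vs ! i) then 1 / d c else 0)"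
          by (rule sum.reindex_bij_betw[OF bij])
        finally show ?thesis
          using d bij_betwE[OF bij] that by simp
      qed
    qed (auto simp: less E_def)
    then show "poly (char_poly (adj_mat n E)) x = (\<Prod>v\<in>V. d v)"
      by (simp add: prod.reindex_bij_betw[OF bij])
  qed
qed

section \<open>Simple extreme roots and the Salem property\<close>

text \<open>At a multiple root \<open>q\<close> vanishes at least quadratically, which a linear
  lower bound on one side excludes. The sign \<open>s\<close> covers both \<open>lam\<close> and
  \<open>- lam\<close>.\<close>

lemma order_eq_1_if_linear_lower_bound:
  fixes q :: "real poly"
  assumes "poly q (s * c) = 0" "C > 0" "\<bar>s\<bar> = 1"
    and bound: "\<And>y. y > c \<Longrightarrow> C * (y - c) \<le> \<bar>poly q (s * y)\<bar>"
  shows "order (s * c) q = 1"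
proof -
  have "q \<noteq> 0"
    using bound[of "c + 1"] \<open>C > 0\<close> by auto
  have False if "2 \<le> order (s * c) q"
  proof -
    have "[:- (s * c), 1:] ^ 2 dvd q"
      using that order_divides by blast
    then obtain g where g: "q = [:- (s * c), 1:] ^ 2 * g" ..
    have le: "C \<le> (y - c) * \<bar>poly g (s * y)\<bar>" if "y > c" for y
    proof -
      have "(s * y - s * c)\<^sup>2 = (y - c)\<^sup>2"
        using \<open>\<bar>s\<bar> = 1\<close> by (auto simp: abs_if power2_eq_square algebra_simps split: if_splits)
      then have "\<bar>poly q (s * y)\<bar> = (y - c) * ((y - c) * \<bar>poly g (s * y)\<bar>)"
        by (simp add: g abs_mult flip: power2_eq_square mult.assoc)
      with bound[OF that] have "(y - c) * C \<le> (y - c) * ((y - c) * \<bar>poly g (s * y)\<bar>)"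
        by (simp add: mult.commute)
      with that show ?thesis by simp
    qed
    \<comment> \<open>Letting \<open>y\<close> tend to \<open>c\<close> from the right turns the
      bound \<open>le\<close> into \<open>C \<le> 0\<close>.\<close>
    have "((\<lambda>y. (y - c) * \<bar>poly g (s * y)\<bar>) \<longlongrightarrow> (c - c) * \<bar>poly g (s * c)\<bar>) (at_right c)"
      by (intro tendsto_intros)
    moreover have "\<forall>\<^sub>F y in at_right c. C \<le> (y - c) * \<bar>poly g (s * y)\<bar>"
      using le by (auto simp: eventually_at_right_field intro: exI[of _ "c + 1"])
    ultimately have "C \<le> (c - c) * \<bar>poly g (s * c)\<bar>"
      by (intro tendsto_lowerbound) auto
    with \<open>C > 0\<close> show False by simp
  qed
  moreover have "order (s * c) q \<noteq> 0"
    using assms(1) \<open>q \<noteq> 0\<close> order_root by blast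
  ultimately show ?thesis by force
qed

text \<open>Symmetry is asked only for absolute values; this suffices to transfer roots and lower
  bounds to the negative side, whatever the sign is.\<close>

lemma bipartite_salem_graphI:
  assumes bip: "bipartite n E" and "lam > 2" "C > 0"
    and sym: "\<And>y. y > 2 \<Longrightarrow>
      \<bar>poly (char_poly (adj_mat n E)) (- y)\<bar> = \<bar>poly (char_poly (adj_mat n E)) y\<bar>"
    and root: "\<And>y. y > 2 \<Longrightarrow> poly (char_poly (adj_mat n E)) y = 0 \<longleftrightarrow> y = lam"
    and bound: "\<And>y. y > lam \<Longrightarrow> C * (y - lam) \<le> \<bar>poly (char_poly (adj_mat n E)) y\<bar>"
  shows "salem_graph n E lam"
proof -
  let ?q = "char_poly (adj_mat n E)"
  have root': "poly ?q y = 0 \<longleftrightarrow> y = - lam" if "y < -2" for y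
    using root[of "-y"] sym[of "-y"] that by auto
  have "{x. poly ?q x = 0 \<and> x \<in> {2<..}} = {lam}"
    using root \<open>lam > 2\<close> by auto
  moreover have "{x. poly ?q x = 0 \<and> x \<in> {..<-2}} = {- lam}"
    using root' \<open>lam > 2\<close> by auto
  moreover have "order (1 * lam) ?q = 1"
    by (rule order_eq_1_if_linear_lower_bound[OF _ \<open>C > 0\<close>]) (use root bound \<open>lam > 2\<close> in auto)
  moreover have "order (-1 * lam) ?q = 1"
    by (rule order_eq_1_if_linear_lower_bound[OF _ \<open>C > 0\<close>])
      (use root' bound sym \<open>lam > 2\<close> in auto)
  ultimately show ?thesis
    using bip \<open>lam > 2\<close> root root'
    by (auto simp: salem_graph_def eig_count_def is_eigenvalue_def)
qed

section \<open>The largest eigenvalue as a function of the path lengths\<close>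

text \<open>The quotient of the characteristic polynomials of the paths on \<open>n - 1\<close> and \<open>n\<close> vertices, with its
  limit as \<open>n \<rightarrow> \<infinity>\<close>; the value at \<open>n = 0\<close> is chosen so that an empty arm contributes nothing.\<close>

primrec path_ratio :: "nat \<Rightarrow> real \<Rightarrow> real" where
  "path_ratio 0 x = 0"
| "path_ratio (Suc n) x = 1 / (x - path_ratio n x)"

definition arm_ratio :: "enat \<Rightarrow> real \<Rightarrow> real" where
  "arm_ratio e x = (case e of enat n \<Rightarrow> path_ratio n x | \<infinity> \<Rightarrow> (x - sqrt (x\<^sup>2 - 4)) / 2)"

lemma arm_ratio_enat [simp]: "arm_ratio (enat n) x = path_ratio n x"
  by (simp add: arm_ratio_def)

lemma arm_ratio_infinity_eq: "arm_ratio \<infinity> x = (x - sqrt (x\<^sup>2 - 4)) / 2"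
  by (simp add: arm_ratio_def)

lemma arm_ratio_infinity:
  assumes "x > 2"
  shows "0 < arm_ratio \<infinity> x" "arm_ratio \<infinity> x < 1" "arm_ratio \<infinity> x * (x - arm_ratio \<infinity> x) = 1"
proof -
  have sq: "x\<^sup>2 > 2\<^sup>2"
    using assms by (intro power_strict_mono) auto
  have "sqrt (x\<^sup>2 - 4) < sqrt (x\<^sup>2)"
    by (rule real_sqrt_less_mono) simp
  then show "0 < arm_ratio \<infinity> x"
    using assms by (simp add: arm_ratio_infinity_eq)
  have "sqrt ((x - 2)\<^sup>2) < sqrt (x\<^sup>2 - 4)"
    using assms by (intro real_sqrt_less_mono) (simp add: power2_eq_square algebra_simps)
  then show "arm_ratio \<infinity> x < 1"
    using assms by (simp add: arm_ratio_infinity_eq)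
  have "sqrt (x\<^sup>2 - 4) * sqrt (x\<^sup>2 - 4) = x\<^sup>2 - 4"
    using sq by simp
  then show "arm_ratio \<infinity> x * (x - arm_ratio \<infinity> x) = 1"
    by (simp add: arm_ratio_infinity_eq field_simps power2_eq_square)
qed

text \<open>The limit value is a fixed point of the increasing map sending \<open>t\<close> to
  \<open>1 / (x - t)\<close>, so the iteration started at 0 stays below it.\<close>

lemma path_ratio_bounds:
  assumes "x > 2"
  shows "0 \<le> path_ratio n x \<and> path_ratio n x < arm_ratio \<infinity> x"
proof (induction n)
  case 0
  then show ?case using arm_ratio_infinity[OF assms] by simp
next
  case (Suc n)
  define l where "l = arm_ratio \<infinity> x"
  note l = arm_ratio_infinity[OF assms, folded l_def]
  have "l = 1 / (x - l)"
    using l assms by (simp add: field_simps)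
  moreover have "1 / (x - path_ratio n x) < 1 / (x - l)"
    using l Suc assms by (intro divide_strict_left_mono mult_pos_pos) (auto simp flip: l_def)
  ultimately show ?case
    using l Suc assms by (simp flip: l_def)
qed

lemma path_ratio_lt_1: "x > 2 \<Longrightarrow> path_ratio n x < 1"
  using path_ratio_bounds[of x n] arm_ratio_infinity(2)[of x] by linarith

lemma path_ratio_less_Suc:
  assumes "x > 2"
  shows "path_ratio n x < path_ratio (Suc n) x"
proof (induction n)
  case 0
  then show ?case using assms by simp
next
  case (Suc n)
  have "1 / (x - path_ratio n x) < 1 / (x - path_ratio (Suc n) x)"
    using Suc assms path_ratio_lt_1[OF assms, of n] path_ratio_lt_1[OF assms, of "Suc n"]
    by (intro divide_strict_left_mono mult_pos_pos) (simp_all del: path_ratio.simps)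
  then show ?case by simp
qed

lemma path_ratio_antimono:
  assumes "2 < x" "x \<le> y"
  shows "path_ratio n y \<le> path_ratio n x"
proof (induction n)
  case (Suc n)
  have "1 / (y - path_ratio n y) \<le> 1 / (x - path_ratio n x)"
    using Suc assms path_ratio_lt_1[of x n] path_ratio_lt_1[of y n]
    by (intro divide_left_mono mult_pos_pos) simp_all
  then show ?case by simp
qed simp

text \<open>The fixed-point iteration contracts: each step multiplies the gap to \<open>l\<close> by
  \<open>l / (x - path_ratio n x)\<close>, which is at most \<open>l < 1\<close>.\<close>

lemma path_ratio_tendsto:
  assumes "x > 2"
  shows "(\<lambda>n. path_ratio n x) \<longlonglongrightarrow> arm_ratio \<infinity> x"
proof -
  define l where "l = arm_ratio \<infinity> x"
  note l = arm_ratio_infinity[OF assms, folded l_def]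
  note b = path_ratio_bounds[OF assms, folded l_def]
  have le: "l - path_ratio n x \<le> l ^ n" for n
  proof (induction n)
    case 0
    then show ?case using l by simp
  next
    case (Suc n)
    have pos: "1 \<le> x - path_ratio n x"
      using assms path_ratio_lt_1[OF assms, of n] by linarith
    have "l * (x - path_ratio n x) - 1 = l * (l - path_ratio n x)"
      using l(3) by (simp add: algebra_simps)
    then have "l - path_ratio (Suc n) x = l * (l - path_ratio n x) / (x - path_ratio n x)"
      using pos by (simp add: field_simps)
    also have "\<dots> \<le> l * (l - path_ratio n x) / 1"
      using pos l b[of n] by (intro divide_left_mono) auto
    also have "\<dots> \<le> l * l ^ n"
      using Suc l by simp
    finally show ?case by simp
  qed
  have "(\<lambda>n. l ^ n) \<longlonglongrightarrow> 0"
    using l by (intro LIMSEQ_realpow_zero) auto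
  then have "(\<lambda>n. l - path_ratio n x) \<longlonglongrightarrow> 0"
    by (rule tendsto_sandwich[rotated 3, where f = "\<lambda>_. 0"])
      (use le b in \<open>auto intro: always_eventually less_imp_le\<close>)
  from tendsto_diff[OF tendsto_const[of l] this] show ?thesis
    by (simp add: l_def)
qed

lemma arm_ratio_bounds:
  assumes "x > 2"
  shows "0 \<le> arm_ratio e x" "arm_ratio e x < 1"
  using arm_ratio_infinity[OF assms] path_ratio_bounds[OF assms] path_ratio_lt_1[OF assms]
  by (cases e; simp)+

lemma arm_ratio_antimono:
  assumes "2 < x" "x \<le> y"
  shows "arm_ratio e y \<le> arm_ratio e x"
proof (cases e)
  case infinity
  have "arm_ratio \<infinity> y \<le> arm_ratio \<infinity> x"
    using assms
    by (intro tendsto_le[OF _ path_ratio_tendsto path_ratio_tendsto])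
      (auto intro: always_eventually path_ratio_antimono)
  with infinity show ?thesis by simp
qed (use assms in \<open>simp add: path_ratio_antimono\<close>)

lemma arm_ratio_strict_mono:
  assumes "x > 2" "e < e'"
  shows "arm_ratio e x < arm_ratio e' x"
proof -
  have "strict_mono (\<lambda>n. path_ratio n x)"
    using path_ratio_less_Suc[OF assms(1)] by (simp add: strict_mono_Suc_iff)
  with assms path_ratio_bounds[OF assms(1)] show ?thesis
    by (cases e; cases e') (auto dest: strict_monoD)
qed

lemma arm_ratio_mono: "x > 2 \<Longrightarrow> e \<le> e' \<Longrightarrow> arm_ratio e x \<le> arm_ratio e' x"
  using arm_ratio_strict_mono[of x e e'] by (cases "e = e'") (auto simp: order_less_le)

lemma continuous_on_arm_ratio: "continuous_on {2<..} (arm_ratio e)"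
proof (cases e)
  case (enat n)
  have "continuous_on {2<..} (path_ratio n)"
  proof (induction n)
    case (Suc n)
    have "\<forall>x\<in>{2<..}. x - path_ratio n x \<noteq> 0"
      using path_ratio_lt_1[of _ n] by force
    with Suc have "continuous_on {2<..} (\<lambda>x. 1 / (x - path_ratio n x))"
      by (intro continuous_intros) auto
    then show ?case by simp
  qed simp
  with enat show ?thesis by (simp add: arm_ratio_def[abs_def])
next
  case infinity
  then show ?thesis
    by (auto simp: arm_ratio_def[abs_def] intro!: continuous_intros)
qed

lemma arm_ratio_tendsto:
  "x > 2 \<Longrightarrow> (\<lambda>n. arm_ratio (enat n) x) \<longlonglongrightarrow> arm_ratio \<infinity> x"
  using path_ratio_tendsto by simp

section \<open>The pivot at the root and its zero\<close>

text \<open>A vertex \<open>Root\<close> is joined to \<open>k\<close> vertices \<open>Mid i\<close>. Arms \<open>2 * i\<close> and \<open>2 * i + 1\<close> hang at \<open>Mid i\<close>,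
  arms \<open>2 * k, \<dots>, 2 * k + r - 1\<close> hang at \<open>Root\<close>; \<open>e j\<close> is the number of vertices of arm \<open>j\<close>.
  Elimination from the leaves of the arms leaves the following pivot at \<open>Root\<close>.\<close>

definition root_pivot :: "nat \<Rightarrow> nat \<Rightarrow> (nat \<Rightarrow> enat) \<Rightarrow> real \<Rightarrow> real" where
  "root_pivot k r e x =
     x - (\<Sum>i<k. 1 / (x - arm_ratio (e (2 * i)) x - arm_ratio (e (2 * i + 1)) x))
       - (\<Sum>j<r. arm_ratio (e (2 * k + j)) x)"

definition root_eig :: "nat \<Rightarrow> nat \<Rightarrow> (nat \<Rightarrow> enat) \<Rightarrow> real" where
  "root_eig k r e = (THE x. x > 2 \<and> root_pivot k r e x = 0)"

lemma mid_pivot_pos: "x > 2 \<Longrightarrow> 0 < x - arm_ratio e x - arm_ratio e' x"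
  using arm_ratio_bounds[of x e] arm_ratio_bounds[of x e'] by linarith

text \<open>The arm ratios decrease in \<open>x\<close>, hence so do both subtracted sums, and the
  leading \<open>x\<close> alone contributes \<open>y - x\<close>. This bound yields uniqueness of
  the zero, an upper bracket for it, and its simplicity as an eigenvalue.\<close>

lemma root_pivot_diff:
  assumes "2 < x" "x \<le> y"
  shows "y - x \<le> root_pivot k r e y - root_pivot k r e x"
proof -
  have "(\<Sum>i<k. 1 / (y - arm_ratio (e (2 * i)) y - arm_ratio (e (2 * i + 1)) y))
      \<le> (\<Sum>i<k. 1 / (x - arm_ratio (e (2 * i)) x - arm_ratio (e (2 * i + 1)) x))"
    using assms
    by (intro sum_mono divide_left_mono mult_pos_pos mid_pivot_pos diff_mono arm_ratio_antimono) auto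
  moreover have "(\<Sum>j<r. arm_ratio (e (2 * k + j)) y) \<le> (\<Sum>j<r. arm_ratio (e (2 * k + j)) x)"
    using assms by (intro sum_mono arm_ratio_antimono)
  ultimately show ?thesis
    by (simp add: root_pivot_def)
qed

lemma root_pivot_antimono:
  assumes "2 < x" "\<And>j. e j \<le> e' j"
  shows "root_pivot k r e' x \<le> root_pivot k r e x"
  unfolding root_pivot_def using assms
  by (intro diff_mono sum_mono divide_left_mono mult_pos_pos mid_pivot_pos arm_ratio_mono) auto

lemma root_pivot_strict_antimono:
  assumes "2 < x" "j < 2 * k + r" "e j < b"
  shows "root_pivot k r (e(j := b)) x < root_pivot k r e x"
proof -
  let ?e = "e(j := b)"
  have le: "e i \<le> ?e i" for i
    using assms by (simp add: less_imp_le)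
  have sum1: "1 / (x - arm_ratio (e i) x - arm_ratio (e i') x)
      \<le> 1 / (x - arm_ratio (?e i) x - arm_ratio (?e i') x)" for i i'
    by (intro divide_left_mono mult_pos_pos mid_pivot_pos diff_mono arm_ratio_mono le assms(1)) auto
  have sum2: "arm_ratio (e i) x \<le> arm_ratio (?e i) x" for i
    by (intro arm_ratio_mono le assms(1))
  have lt: "arm_ratio (e j) x < arm_ratio (?e j) x"
    using assms by (simp add: arm_ratio_strict_mono)
  let ?S = "\<lambda>e. \<Sum>i<k. 1 / (x - arm_ratio (e (2 * i)) x - arm_ratio (e (2 * i + 1)) x)"
  let ?R = "\<lambda>e. \<Sum>j<r. arm_ratio (e (2 * k + j)) x"
  have le_S: "?S e \<le> ?S ?e"
    by (intro sum_mono sum1)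
  have le_R: "?R e \<le> ?R ?e"
    by (intro sum_mono sum2)
  \<comment> \<open>Arm \<open>j\<close> occurs in exactly one summand: that of
    \<open>Mid (j div 2)\<close> when \<open>j < 2 * k\<close>, and otherwise summand
    \<open>j - 2 * k\<close> of the second sum.\<close>
  have "?S e < ?S ?e \<or> ?R e < ?R ?e"
  proof (cases "j < 2 * k")
    case True
    have "?S e < ?S ?e"
    proof (rule sum_strict_mono_ex1)
      show "\<exists>i\<in>{..<k}. 1 / (x - arm_ratio (e (2 * i)) x - arm_ratio (e (2 * i + 1)) x)
          < 1 / (x - arm_ratio (?e (2 * i)) x - arm_ratio (?e (2 * i + 1)) x)"
      proof (rule bexI[of _ "j div 2"])
        have "j = 2 * (j div 2) \<or> j = 2 * (j div 2) + 1"
          by linarith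
        then have "x - arm_ratio (?e (2 * (j div 2))) x - arm_ratio (?e (2 * (j div 2) + 1)) x
            < x - arm_ratio (e (2 * (j div 2))) x - arm_ratio (e (2 * (j div 2) + 1)) x"
          using lt sum2[of "2 * (j div 2)"] sum2[of "2 * (j div 2) + 1"] by (smt (verit))
        then show "1 / (x - arm_ratio (e (2 * (j div 2))) x - arm_ratio (e (2 * (j div 2) + 1)) x)
            < 1 / (x - arm_ratio (?e (2 * (j div 2))) x - arm_ratio (?e (2 * (j div 2) + 1)) x)"
          by (intro divide_strict_left_mono mult_pos_pos mid_pivot_pos assms(1)) auto
      qed (use True in auto)
    qed (use sum1 in auto)
    then show ?thesis ..
  next
    case False
    have "?R e < ?R ?e"
    proof (rule sum_strict_mono_ex1)
      show "\<exists>i\<in>{..<r}. arm_ratio (e (2 * k + i)) x < arm_ratio (?e (2 * k + i)) x"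
        using lt False assms(2) by (intro bexI[of _ "j - 2 * k"]) auto
    qed (use sum2 in auto)
    then show ?thesis ..
  qed
  with le_S le_R show ?thesis
    unfolding root_pivot_def by linarith
qed

lemma root_pivot_cong:
  assumes "\<And>j. j < 2 * k + r \<Longrightarrow> e j = e' j"
  shows "root_pivot k r e x = root_pivot k r e' x"
  unfolding root_pivot_def using assms by (intro arg_cong2[of _ _ _ _ minus] sum.cong) auto

lemma continuous_on_root_pivot: "continuous_on {2<..} (root_pivot k r e)"
proof -
  have "\<forall>x\<in>{2<..}. x - arm_ratio a x - arm_ratio b x \<noteq> 0" for a b
    using mid_pivot_pos[of _ a b] by force
  then show ?thesis
    unfolding root_pivot_def[abs_def]
    by (intro continuous_intros continuous_on_arm_ratio) auto
qed

lemma root_pivot_tendsto: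
  assumes "x > 2" "\<And>j. (\<lambda>n. arm_ratio (f n j) x) \<longlonglongrightarrow> arm_ratio (e j) x"
  shows "(\<lambda>n. root_pivot k r (f n) x) \<longlonglongrightarrow> root_pivot k r e x"
  unfolding root_pivot_def
  by (intro tendsto_intros assms) (metis assms(1) mid_pivot_pos less_irrefl)

lemma root_pivot_less_iff:
  assumes "2 < x" "2 < y"
  shows "root_pivot k r e x < root_pivot k r e y \<longleftrightarrow> x < y"
  using root_pivot_diff[of x y k r e] root_pivot_diff[of y x k r e] assms by linarith

lemma root_eig_eqI:
  assumes "x > 2" "root_pivot k r e x = 0"
  shows "root_eig k r e = x"
  unfolding root_eig_def
proof (rule the_equality)
  show "y = x" if "2 < y \<and> root_pivot k r e y = 0" for y
    using that assms root_pivot_less_iff[of x y k r e] root_pivot_less_iff[of y x k r e]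
    by linarith
qed (use assms in simp)

lemma root_eig_works:
  assumes "x > 2" "root_pivot k r e x < 0"
  shows "x < root_eig k r e" "root_pivot k r e (root_eig k r e) = 0"
proof -
  \<comment> \<open>Since the slope is at least 1, moving right by the size of the negative value
    reaches a nonnegative value.\<close>
  define y where "y = x - root_pivot k r e x"
  have "x \<le> y"
    using assms by (simp add: y_def)
  then have "0 \<le> root_pivot k r e y"
    using root_pivot_diff[of x y k r e] assms by (simp add: y_def)
  moreover have "continuous_on {x..y} (root_pivot k r e)"
    by (rule continuous_on_subset[OF continuous_on_root_pivot]) (use assms in auto)
  ultimately obtain z where z: "x \<le> z" "root_pivot k r e z = 0"
    using IVT'[of "root_pivot k r e" x 0 y] assms \<open>x \<le> y\<close> by auto
  with assms have "x < z"
    by (cases "x = z") auto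
  with z show "x < root_eig k r e" "root_pivot k r e (root_eig k r e) = 0"
    using root_eig_eqI[of z k r e] assms by auto
qed

text \<open>Letting one finite arm grow makes the largest eigenvalue converge from strictly below.\<close>

lemma root_eig_limit:
  assumes "x > 2" and neg: "root_pivot k r (\<lambda>_. enat N) x < 0"
    and e: "\<And>i. enat N \<le> e i" "e j = \<infinity>" "j < 2 * k + r"
  shows "(\<lambda>n. root_eig k r (e(j := enat n))) \<longlonglongrightarrow> root_eig k r e"
    and "\<forall>\<^sub>F n in sequentially. root_eig k r (e(j := enat n)) < root_eig k r e"
proof -
  have neg': "root_pivot k r f x < 0" if "\<And>i. enat N \<le> f i" for f
    using root_pivot_antimono[OF \<open>x > 2\<close>, of "\<lambda>_. enat N" f k r] neg that by simp
  have lam: "x < root_eig k r e" "root_pivot k r e (root_eig k r e) = 0"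
    using root_eig_works[OF \<open>x > 2\<close> neg'] e(1) by auto
  have lam_n: "x < root_eig k r (e(j := enat n))"
    "root_pivot k r (e(j := enat n)) (root_eig k r (e(j := enat n))) = 0" if "n \<ge> N" for n
    using root_eig_works[OF \<open>x > 2\<close> neg', of "e(j := enat n)"] e(1) that by auto
  have less: "root_eig k r (e(j := enat n)) < root_eig k r e" if "n \<ge> N" for n
  proof -
    \<comment> \<open>Viewing \<open>e\<close> as a lengthening of the truncated family makes strict
      monotonicity in arm \<open>j\<close> applicable.\<close>
    have "e = (e(j := enat n))(j := \<infinity>)"
      using e(2) by auto
    then have "root_pivot k r e (root_eig k r e) < root_pivot k r (e(j := enat n)) (root_eig k r e)"
      using root_pivot_strict_antimono[of "root_eig k r e" j k r "e(j := enat n)" \<infinity>]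
        lam \<open>x > 2\<close> e(3) by simp
    then show ?thesis
      using root_pivot_less_iff[of "root_eig k r (e(j := enat n))" "root_eig k r e"
          k r "e(j := enat n)"] lam lam_n[OF that] \<open>x > 2\<close> by simp
  qed
  then show ev: "\<forall>\<^sub>F n in sequentially. root_eig k r (e(j := enat n)) < root_eig k r e"
    using eventually_sequentially by blast
  show "(\<lambda>n. root_eig k r (e(j := enat n))) \<longlonglongrightarrow> root_eig k r e"
  proof (rule order_tendstoI)
    fix a assume "a < root_eig k r e"
    define y where "y = max a x"
    have y: "a \<le> y" "2 < y" "y < root_eig k r e"
      using \<open>a < root_eig k r e\<close> lam \<open>x > 2\<close> by (auto simp: y_def)
    \<comment> \<open>The limiting pivot is negative at \<open>y\<close>, so the truncated pivots
      eventually are too, which pushes their zeros beyond \<open>y\<close>.\<close>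
    have "(\<lambda>n. arm_ratio ((e(j := enat n)) i) y) \<longlonglongrightarrow> arm_ratio (e i) y" for i
      using arm_ratio_tendsto[OF y(2)] e(2) by (cases "i = j") auto
    then have "(\<lambda>n. root_pivot k r (e(j := enat n)) y) \<longlonglongrightarrow> root_pivot k r e y"
      by (rule root_pivot_tendsto[OF y(2)])
    moreover have "root_pivot k r e y < 0"
      using root_pivot_less_iff[of y "root_eig k r e" k r e] lam y by simp
    ultimately have "\<forall>\<^sub>F n in sequentially. root_pivot k r (e(j := enat n)) y < 0"
      by (rule order_tendstoD)
    then show "\<forall>\<^sub>F n in sequentially. a < root_eig k r (e(j := enat n))"
      by eventually_elim (use root_eig_works[OF y(2)] y(1) in force)
  next
    fix a assume "root_eig k r e < a"
    from ev show "\<forall>\<^sub>F n in sequentially. root_eig k r (e(j := enat n)) < a"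
      by eventually_elim (use \<open>root_eig k r e < a\<close> in simp)
  qed
qed

section \<open>The trees and the derived sets\<close>

text \<open>\<open>Arm j q\<close> is the vertex of arm \<open>j\<close> at position
  \<open>q\<close>, counted from the point of attachment.\<close>

datatype vertex = Root | Mid nat | Arm nat nat

definition attach :: "nat \<Rightarrow> nat \<Rightarrow> vertex" where
  "attach k j = (if j < 2 * k then Mid (j div 2) else Root)"

fun parent :: "nat \<Rightarrow> vertex \<Rightarrow> vertex option" where
  "parent k Root = None"
| "parent k (Mid i) = Some Root"
| "parent k (Arm j 0) = Some (attach k j)"
| "parent k (Arm j (Suc q)) = Some (Arm j q)"

fun depth :: "nat \<Rightarrow> vertex \<Rightarrow> nat" where
  "depth k Root = 0"
| "depth k (Mid i) = 1"
| "depth k (Arm j q) = q + (if j < 2 * k then 2 else 1)"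

definition vertices :: "nat \<Rightarrow> nat \<Rightarrow> (nat \<Rightarrow> nat) \<Rightarrow> vertex set" where
  "vertices k r a = insert Root (Mid ` {..<k} \<union> (\<Union>j<2 * k + r. Arm j ` {..<a j}))"

text \<open>From \<open>Arm j q\<close> outwards there are \<open>a j - q\<close> vertices, counting
  itself; the pivot is the reciprocal of the ratio for that path.\<close>

fun pivot :: "nat \<Rightarrow> nat \<Rightarrow> (nat \<Rightarrow> nat) \<Rightarrow> real \<Rightarrow> vertex \<Rightarrow> real" where
  "pivot k r a x Root = root_pivot k r (\<lambda>j. enat (a j)) x"
| "pivot k r a x (Mid i) = x - path_ratio (a (2 * i)) x - path_ratio (a (2 * i + 1)) x"
| "pivot k r a x (Arm j q) = 1 / path_ratio (a j - q) x"

lemma parent_depth: "parent k c = Some v \<Longrightarrow> depth k c = Suc (depth k v)"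
  by (induction k c rule: parent.induct) (auto simp: attach_def)

lemma sum_vertices:
  fixes f :: "vertex \<Rightarrow> real"
  shows "(\<Sum>v\<in>vertices k r a. f v) =
    f Root + (\<Sum>i<k. f (Mid i)) + (\<Sum>j<2 * k + r. \<Sum>q<a j. f (Arm j q))"
proof -
  let ?M = "Mid ` {..<k}" and ?A = "\<Union>j<2 * k + r. Arm j ` {..<a j}"
  have "(\<Sum>v\<in>vertices k r a. f v) = f Root + (sum f ?M + sum f ?A)"
    unfolding vertices_def by (subst sum.insert; (subst sum.union_disjoint)?) auto
  also have "sum f ?M = (\<Sum>i<k. f (Mid i))"
    by (subst sum.reindex) (auto simp: inj_on_def)
  also have "sum f ?A = (\<Sum>j<2 * k + r. sum f (Arm j ` {..<a j}))"
    by (intro sum.UNION_disjoint) auto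
  also have "\<dots> = (\<Sum>j<2 * k + r. \<Sum>q<a j. f (Arm j q))"
    by (intro sum.cong refl, subst sum.reindex) (auto simp: inj_on_def)
  finally show ?thesis by simp
qed

text \<open>An arm contributes to the pivot equation at \<open>v\<close> through at most one child:
  its first vertex if it hangs at \<open>v\<close>, or the next vertex if \<open>v\<close> lies on
  it. At the tip and for an empty arm, \<open>path_ratio 0 x = 0\<close> gives the right
  value.\<close>

lemma sum_arm_children:
  assumes "x > 2"
  shows "(\<Sum>q<a j. if parent k (Arm j q) = Some v then 1 / pivot k r a x (Arm j q) else 0) =
    (case v of Arm i q \<Rightarrow> if i = j then path_ratio (a j - Suc q) x else 0
       | _ \<Rightarrow> if attach k j = v then path_ratio (a j) x else 0)"
    (is "(\<Sum>q<a j. ?f q) = ?rhs")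
proof (cases "a j")
  case (Suc n)
  have "(\<Sum>q<a j. ?f q) = ?f 0 + (\<Sum>q<n. ?f (Suc q))"
    by (simp add: Suc sum.lessThan_Suc_shift del: sum.lessThan_Suc)
  also have "(\<Sum>q<n. ?f (Suc q)) =
      (\<Sum>q<n. if v = Arm j q then path_ratio (a j - Suc q) x else 0)"
    by (intro sum.cong) auto
  also have "\<dots> = (case v of Arm i q \<Rightarrow> if i = j then path_ratio (a j - Suc q) x else 0 | _ \<Rightarrow> 0)"
  proof (cases v)
    case (Arm i q)
    then show ?thesis
      using Suc by (cases "i = j"; cases "q < n") (simp_all add: eq_commute[of q])
  qed auto
  finally show ?thesis
    by (cases v) (auto simp: attach_def)
qed (auto split: vertex.split)

lemma sum_lessThan_double: "(\<Sum>j<2 * k. f j) = (\<Sum>i<k. f (2 * i) + f (2 * i + 1 :: nat) :: real)"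
  by (induction k) auto

lemma pivot_eq:
  assumes "x > 2" "v \<in> vertices k r a"
  shows "pivot k r a x v =
    x - (\<Sum>c\<in>vertices k r a. if parent k c = Some v then 1 / pivot k r a x c else 0)"
proof -
  let ?f = "\<lambda>c. if parent k c = Some v then 1 / pivot k r a x c else 0"
  have sum: "(\<Sum>c\<in>vertices k r a. ?f c) = (\<Sum>i<k. ?f (Mid i)) +
      (\<Sum>j<2 * k + r. case v of Arm i q \<Rightarrow> if i = j then path_ratio (a j - Suc q) x else 0
       | _ \<Rightarrow> if attach k j = v then path_ratio (a j) x else 0)"
    by (simp only: sum_vertices sum_arm_children[OF assms(1)]) simp
  show ?thesis
  proof (cases v)
    case Root
    have "(\<Sum>j<2 * k + r. if attach k j = Root then path_ratio (a j) x else 0) =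
        (\<Sum>j<r. path_ratio (a (2 * k + j)) x)"
      by (induction r) (auto simp: attach_def)
    with Root show ?thesis
      unfolding sum by (simp add: root_pivot_def)
  next
    case (Mid i)
    with assms have "i < k" by (auto simp: vertices_def)
    have "(\<Sum>j<2 * k + r. if attach k j = Mid i then path_ratio (a j) x else 0) =
        (\<Sum>j<2 * k. if attach k j = Mid i then path_ratio (a j) x else 0)"
      by (induction r) (auto simp: attach_def)
    also have "\<dots> = (\<Sum>i'<k. if i' = i then path_ratio (a (2 * i)) x + path_ratio (a (2 * i + 1)) x else 0)"
      unfolding sum_lessThan_double by (intro sum.cong) (auto simp: attach_def)
    finally show ?thesis
      unfolding sum using \<open>i < k\<close> by (simp add: Mid)
  next
    case (Arm j q)
    with assms have "j < 2 * k + r" "q < a j" by (auto simp: vertices_def)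
    then have "a j - q = Suc (a j - Suc q)" by simp
    with Arm \<open>j < 2 * k + r\<close> show ?thesis
      unfolding sum by (simp add: eq_commute[of j])
  qed
qed

text \<open>All ratios are below 1, so a \<open>Mid\<close> pivot exceeds \<open>x - 2\<close> and
  an arm pivot exceeds \<open>x - 1\<close>, hence 1.\<close>

lemma pivot_ge:
  assumes "x > 2" "v \<in> vertices k r a" "v \<noteq> Root"
  shows "min 1 (x - 2) \<le> pivot k r a x v"
proof (cases v)
  case (Mid i)
  then show ?thesis
    using path_ratio_lt_1[OF assms(1), of "a (2 * i)"]
      path_ratio_lt_1[OF assms(1), of "a (2 * i + 1)"] by simp
next
  case (Arm j q)
  with assms have "0 < a j - q" by (auto simp: vertices_def)
  then obtain n where "a j - q = Suc n" using gr0_implies_Suc by blast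
  then show ?thesis
    using path_ratio_lt_1[OF assms(1), of n] assms(1) by (simp add: Arm)
qed (use assms in auto)

lemma salem_tree_exists:
  assumes "lam > 2" "root_pivot k r (\<lambda>j. enat (a j)) lam = 0"
  obtains n E where "simple_graph n E" "bipartite n E" "salem_graph n E lam"
proof -
  let ?V = "vertices k r a"
  have fin: "finite ?V"
    by (simp add: vertices_def)
  obtain n E where E: "simple_graph n E" "bipartite n E"
    and char_poly: "\<And>d x. (\<And>c v. c \<in> ?V \<Longrightarrow> parent k c = Some v \<Longrightarrow> d c \<noteq> 0) \<Longrightarrow>
      (\<And>v. v \<in> ?V \<Longrightarrow> d v = x - (\<Sum>c\<in>?V. if parent k c = Some v then 1 / d c else 0)) \<Longrightarrow>
      poly (char_poly (adj_mat n E)) x = (\<Prod>v\<in>?V. d v)"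
    by (rule forest_graph_exists[OF fin, of "parent k" "depth k"]) (use parent_depth in auto)
  let ?q = "char_poly (adj_mat n E)" and ?d = "pivot k r a" and ?h = "root_pivot k r (\<lambda>j. enat (a j))"
  have pos: "0 < ?d x v" if "x > 2" "v \<in> ?V - {Root}" for x v
    using pivot_ge[of x v k r a] that by auto
  have nz: "?d x v \<noteq> 0" if "x > 2" "v \<in> ?V" "parent k v = Some w" for x v w
    using pos[of x v] that by (cases "v = Root") auto
  have q: "poly ?q x = (\<Prod>v\<in>?V. ?d x v)" if "x > 2" for x
    using nz[OF that] pivot_eq[OF that] by (intro char_poly) auto
  \<comment> \<open>Negating all pivots solves the elimination recursion at
    \<open>- x\<close>.\<close>
  have q_neg: "poly ?q (- x) = (\<Prod>v\<in>?V. - ?d x v)" if "x > 2" for x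
  proof (intro char_poly)
    show "- ?d x v = - x - (\<Sum>c\<in>?V. if parent k c = Some v then 1 / - ?d x c else 0)"
      if "v \<in> ?V" for v
      by (subst pivot_eq[OF \<open>x > 2\<close> that]) (simp flip: sum_negf add: if_distrib cong: if_cong)
  qed (use nz[OF that] in auto)
  have q': "poly ?q x = ?h x * (\<Prod>v\<in>?V - {Root}. ?d x v)" if "x > 2" for x
    unfolding q[OF that] by (subst prod.remove[OF fin, of Root]) (auto simp: vertices_def)
  have prod_pos: "0 < (\<Prod>v\<in>?V - {Root}. ?d x v)" if "x > 2" for x
    using pos[OF that] by (intro prod_pos) auto
  have root: "?h y = 0 \<longleftrightarrow> y = lam" if "y > 2" for y
    using root_pivot_less_iff[OF that assms(1), of k r] root_pivot_less_iff[OF assms(1) that, of k r]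
      assms(2) by (metis linorder_neq_iff)
  show thesis
  proof (rule that[OF E])
    show "salem_graph n E lam"
    proof (rule bipartite_salem_graphI[OF E(2) assms(1)])
      show "\<bar>poly ?q (- y)\<bar> = \<bar>poly ?q y\<bar>" if "y > 2" for y
        unfolding q[OF that] q_neg[OF that] by (simp add: abs_prod)
      show "poly ?q y = 0 \<longleftrightarrow> y = lam" if "y > 2" for y
        using root[OF that] prod_pos[OF that] by (simp add: q'[OF that])
      \<comment> \<open>For \<open>y > lam\<close> every non-root pivot is at least
        \<open>min 1 (lam - 2)\<close>, and the root pivot is at least
        \<open>y - lam\<close>.\<close>
      show "0 < min 1 (lam - 2) ^ card (?V - {Root})"
        using assms(1) by simp
      show "min 1 (lam - 2) ^ card (?V - {Root}) * (y - lam) \<le> \<bar>poly ?q y\<bar>" if "y > lam" for y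
      proof -
        have y: "y > 2" using that assms(1) by simp
        have "min 1 (lam - 2) ^ card (?V - {Root}) = (\<Prod>v\<in>?V - {Root}. min 1 (lam - 2))"
          by simp
        also have "\<dots> \<le> (\<Prod>v\<in>?V - {Root}. ?d y v)"
          using pivot_ge[OF y] that assms(1) by (intro prod_mono) fastforce
        finally have "min 1 (lam - 2) ^ card (?V - {Root}) * (y - lam)
            \<le> (\<Prod>v\<in>?V - {Root}. ?d y v) * ?h y"
          using root_pivot_diff[of lam y k r "\<lambda>j. enat (a j)"] assms that prod_pos[OF y]
          by (intro mult_mono) auto
        also have "\<dots> \<le> \<bar>poly ?q y\<bar>"
          by (simp add: q'[OF y] mult.commute)
        finally show ?thesis .
      qed
    qed
  qed
qed

section \<open>From eigenvalues to iterated limit points\<close>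

definition tau_of :: "real \<Rightarrow> real" where
  "tau_of lam = ((lam + sqrt (lam ^ 2 - 4)) / 2) ^ 2"

lemma tau_of_strict_mono:
  assumes "2 < x" "x < y"
  shows "tau_of x < tau_of y"
proof -
  have "x\<^sup>2 < y\<^sup>2"
    using assms by (intro power_strict_mono) auto
  moreover have "2\<^sup>2 < x\<^sup>2"
    by (rule power_strict_mono) (use assms in auto)
  ultimately have "x\<^sup>2 < y\<^sup>2" "0 < x\<^sup>2 - 4"
    by simp_all
  then show ?thesis
    unfolding tau_of_def using assms
    by (intro power_strict_mono divide_strict_right_mono add_strict_mono real_sqrt_less_mono) auto
qed

lemma tau_of_in_T_graph:
  assumes "lam > 2" "root_pivot k r (\<lambda>j. enat (a j)) lam = 0" "lam\<^sup>2 \<notin> \<int>"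
  shows "tau_of lam \<in> T_graph"
proof -
  obtain n E where "simple_graph n E" "bipartite n E" "salem_graph n E lam"
    using salem_tree_exists[OF assms(1,2)] .
  with assms(3) show ?thesis
    unfolding T_graph_def tau_of_def by (auto simp: tau_def trivial_salem_def intro!: exI)
qed

lemma derived_set_S_graph: "derived_set j S_graph = derived_set (Suc j) T_graph"
  by (induction j) (simp_all add: S_graph_def)

lemma islimpt_if_tendsto_below:
  fixes s :: "nat \<Rightarrow> real"
  assumes "s \<longlonglongrightarrow> l" "\<forall>\<^sub>F n in sequentially. s n < l" "\<forall>\<^sub>F n in sequentially. s n \<in> A"
  shows "l islimpt A"
  unfolding islimpt_approachable
proof (intro allI impI)
  fix e :: real assume "e > 0"
  with assms(1) have "\<forall>\<^sub>F n in sequentially. dist (s n) l < e"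
    by (rule tendstoD)
  with assms(2,3) have "\<forall>\<^sub>F n in sequentially. s n \<in> A \<and> s n \<noteq> l \<and> dist (s n) l < e"
    by eventually_elim auto
  then show "\<exists>x\<in>A. x \<noteq> l \<and> dist x l < e"
    unfolding eventually_sequentially by blast
qed

text \<open>The terms end up strictly between \<open>\<lceil>l\<rceil> - 1\<close> and
  \<open>l\<close>, where there is no integer. Applied to squared eigenvalues, this rules out
  trivial Salem graphs.\<close>

lemma eventually_not_Ints_if_tendsto_below:
  fixes s :: "nat \<Rightarrow> real"
  assumes "s \<longlonglongrightarrow> l" "\<forall>\<^sub>F n in sequentially. s n < l"
  shows "\<forall>\<^sub>F n in sequentially. s n \<notin> \<int>"
proof -
  have "\<forall>\<^sub>F n in sequentially. of_int (\<lceil>l\<rceil> - 1) < s n"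
    using assms(1) by (rule order_tendstoD) linarith
  with assms(2) show ?thesis
  proof eventually_elim
    case (elim n)
    show ?case
    proof
      assume "s n \<in> \<int>"
      then obtain z where "s n = of_int z" by (elim Ints_cases)
      with elim have "\<lceil>l\<rceil> - 1 < z" "z < \<lceil>l\<rceil>"
        by (auto simp: less_ceiling_iff)
      then show False by simp
    qed
  qed
qed

lemma tau_of_islimpt:
  assumes "x > 2" and neg: "root_pivot k r (\<lambda>_. enat N) x < 0"
    and e: "\<And>i. enat N \<le> e i" "e j = \<infinity>" "j < 2 * k + r"
    and A: "\<forall>\<^sub>F n in sequentially. tau_of (root_eig k r (e(j := enat n))) \<in> A"
  shows "tau_of (root_eig k r e) islimpt A"
proof -
  have gt: "x < root_eig k r f" if "\<And>i. enat N \<le> f i" for f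
    using root_eig_works(1)[OF assms(1)] neg that
      root_pivot_antimono[OF \<open>x > 2\<close>, of "\<lambda>_. enat N" f k r] by fastforce
  have gt_n: "\<forall>\<^sub>F n in sequentially. 2 < root_eig k r (e(j := enat n))"
    using eventually_ge_at_top[of N]
    by eventually_elim (use gt[of "e(j := enat _)"] e(1) \<open>x > 2\<close> in force)
  show ?thesis
  proof (rule islimpt_if_tendsto_below)
    show "(\<lambda>n. tau_of (root_eig k r (e(j := enat n)))) \<longlonglongrightarrow> tau_of (root_eig k r e)"
      unfolding tau_of_def by (intro tendsto_intros root_eig_limit[OF assms(1,2)] e) auto
    show "\<forall>\<^sub>F n in sequentially. tau_of (root_eig k r (e(j := enat n))) < tau_of (root_eig k r e)"
      using root_eig_limit(2)[of x k r N e j] assms gt_n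
      by (auto elim: eventually_elim2 simp: tau_of_strict_mono)
  qed (fact A)
qed

text \<open>Arms \<open>0\<close> to \<open>j\<close> are infinite. Truncating arm \<open>j\<close>
  gives values one derived set lower that increase strictly towards the limit; once arm
  \<open>0\<close> is truncated, all arms are finite and the value comes from an actual tree. The
  common lower bound \<open>N\<close> keeps every eigenvalue involved above
  \<open>x > 2\<close>.\<close>

lemma tau_of_in_derived_set:
  assumes "x > 2" and neg: "root_pivot k r (\<lambda>_. enat N) x < 0" and "j < 2 * k + r"
    and "\<And>i. i \<le> j \<Longrightarrow> e i = \<infinity>" "\<And>i. i > j \<Longrightarrow> e i \<noteq> \<infinity>" "\<And>i. enat N \<le> e i"
  shows "tau_of (root_eig k r e) \<in> derived_set (Suc j) T_graph"
  using assms(3-)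
proof (induction j arbitrary: e)
  case 0
  have works: "2 < root_eig k r (e(0 := enat n))"
    "root_pivot k r (e(0 := enat n)) (root_eig k r (e(0 := enat n))) = 0" if "n \<ge> N" for n
  proof -
    have "root_pivot k r (e(0 := enat n)) x \<le> root_pivot k r (\<lambda>_. enat N) x"
      using 0 that by (intro root_pivot_antimono assms) auto
    with neg root_eig_works[OF assms(1), of k r "e(0 := enat n)"] assms(1)
    show "2 < root_eig k r (e(0 := enat n))"
      "root_pivot k r (e(0 := enat n)) (root_eig k r (e(0 := enat n))) = 0"
      by auto
  qed
  have fin: "\<exists>a. e(0 := enat n) = (\<lambda>j. enat (a j))" for n
  proof -
    have "\<forall>j. \<exists>m. (e(0 := enat n)) j = enat m"
      using 0(3) by (metis fun_upd_apply gr0I not_infinity_eq)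
    then show ?thesis by (metis ext)
  qed
  let ?s = "\<lambda>n. root_eig k r (e(0 := enat n))"
  have lim: "?s \<longlonglongrightarrow> root_eig k r e" "\<forall>\<^sub>F n in sequentially. ?s n < root_eig k r e"
    using root_eig_limit[OF assms(1,2), of e 0] 0 by auto
  have "\<forall>\<^sub>F n in sequentially. (?s n)\<^sup>2 \<notin> \<int>"
  proof (rule eventually_not_Ints_if_tendsto_below)
    show "(\<lambda>n. (?s n)\<^sup>2) \<longlonglongrightarrow> (root_eig k r e)\<^sup>2"
      by (intro tendsto_intros lim)
    show "\<forall>\<^sub>F n in sequentially. (?s n)\<^sup>2 < (root_eig k r e)\<^sup>2"
      using lim(2) eventually_ge_at_top[of N]
      by eventually_elim (use works(1) in \<open>force intro: power_strict_mono\<close>)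
  qed
  then have "\<forall>\<^sub>F n in sequentially. tau_of (?s n) \<in> T_graph"
    using eventually_ge_at_top[of N]
    by eventually_elim (use works fin tau_of_in_T_graph in metis)
  then show ?case
    using tau_of_islimpt[OF assms(1,2), of e 0] 0 by simp
next
  case (Suc j)
  have "\<forall>\<^sub>F n in sequentially.
      tau_of (root_eig k r (e(Suc j := enat n))) \<in> derived_set (Suc j) T_graph"
    using eventually_ge_at_top[of N]
  proof eventually_elim
    case (elim n)
    with Suc.prems show ?case by (intro Suc.IH) auto
  qed
  then show ?case
    using tau_of_islimpt[OF assms(1,2), of e "Suc j"] Suc.prems by simp
qed

lemma tau_of_in_derived_set_S_graph:
  assumes "x > 2" "root_pivot k r (\<lambda>_. \<infinity>) x = 0" "2 * k + r \<noteq> 0"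
  shows "tau_of x \<in> derived_set (2 * k + r - 1) S_graph"
proof -
  obtain y where y: "2 < y" "y < x"
    using dense[OF assms(1)] by blast
  have "(\<lambda>n. root_pivot k r (\<lambda>_. enat n) y) \<longlonglongrightarrow> root_pivot k r (\<lambda>_. \<infinity>) y"
    by (intro root_pivot_tendsto arm_ratio_tendsto y)
  moreover have "root_pivot k r (\<lambda>_. \<infinity>) y < 0"
    using root_pivot_less_iff[of y x k r "\<lambda>_. \<infinity>"] assms y by simp
  ultimately have "\<forall>\<^sub>F n in sequentially. root_pivot k r (\<lambda>_. enat n) y < 0"
    by (rule order_tendstoD)
  then obtain N where N: "root_pivot k r (\<lambda>_. enat N) y < 0"
    unfolding eventually_sequentially by blast
  \<comment> \<open>The induction wants finite entries beyond the last arm;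
    \<open>root_pivot\<close> does not read them, so the zero is still \<open>x\<close>.\<close>
  define e where "e i = (if i < 2 * k + r then \<infinity> else enat N)" for i
  have "tau_of (root_eig k r e) \<in> derived_set (Suc (2 * k + r - 1)) T_graph"
    by (rule tau_of_in_derived_set[OF y(1) N]) (use assms(3) in \<open>auto simp: e_def\<close>)
  moreover have "root_eig k r e = x"
    using assms root_pivot_cong[of k r e "\<lambda>_. \<infinity>" x] by (intro root_eig_eqI) (auto simp: e_def)
  ultimately show ?thesis
    by (simp add: derived_set_S_graph)
qed

text \<open>With \<open>x = t + 1 / t\<close> and \<open>z = t\<^sup>2\<close>, the limiting equation becomes a quadratic in \<open>z\<close>.\<close>

lemma in_derived_set_S_graph:
  assumes "z > 1" and eq: "z\<^sup>2 - 1 = real k * z + real r * (z - 1)" and "2 * k + r \<noteq> 0"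
  shows "z \<in> derived_set (2 * k + r - 1) S_graph"
proof -
  define t where "t = sqrt z"
  define x where "x = t + 1 / t"
  have t: "t > 1" "t\<^sup>2 = z"
    using assms(1) by (auto simp: t_def)
  have "0 < (t - 1)\<^sup>2 / t"
    using t by simp
  also have "(t - 1)\<^sup>2 / t = x - 2"
    using t by (simp add: x_def field_simps power2_eq_square)
  finally have "x > 2" by simp
  have "x\<^sup>2 - 4 = (t - 1 / t)\<^sup>2"
    using t(1) by (simp add: x_def field_simps power2_eq_square)
  moreover have "1 / t < t"
    using t(1) less_1_mult[OF t(1) t(1)] by (simp add: field_simps)
  ultimately have sqrt: "sqrt (x\<^sup>2 - 4) = t - 1 / t"
    by simp
  have "arm_ratio \<infinity> x = 1 / t"
    unfolding arm_ratio_infinity_eq sqrt by (simp add: x_def)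
  then have "root_pivot k r (\<lambda>_. \<infinity>) x = t + 1 / t - real k / (t - 1 / t) - real r / t"
    by (simp add: root_pivot_def x_def)
  also have "\<dots> = (t\<^sup>2 + 1) / t - real k * t / (t\<^sup>2 - 1) - real r / t"
    using t by (simp add: field_simps power2_eq_square)
  also have "\<dots> = ((t\<^sup>2)\<^sup>2 - 1 - real k * t\<^sup>2 - real r * (t\<^sup>2 - 1)) / (t * (t\<^sup>2 - 1))"
    using t assms(1) by (simp add: divide_simps) (simp add: algebra_simps power2_eq_square)
  also have "\<dots> = 0"
    using eq by (simp add: t)
  finally have "tau_of x \<in> derived_set (2 * k + r - 1) S_graph"
    using tau_of_in_derived_set_S_graph[OF \<open>x > 2\<close>] assms(3) by simp
  \<comment> \<open>Here \<open>(x + sqrt (x\<^sup>2 - 4)) / 2 = t\<close>, so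
    \<open>tau_of x = t\<^sup>2 = z\<close>.\<close>
  then show ?thesis
    by (simp add: tau_of_def sqrt) (simp add: x_def t)
qed

theorem theorem17:
  fixes k :: nat
  assumes "k \<ge> 1"
  shows "(real k + sqrt (real k ^ 2 + 4)) / 2 \<in> derived_set (2 * k - 1) S_graph
       \<and> real k + 1 \<in> derived_set (2 * k) S_graph"
proof
  let ?s = "sqrt (real k ^ 2 + 4)"
  have s: "?s\<^sup>2 = real k ^ 2 + 4" "?s > 2"
    using assms by (auto intro!: real_less_rsqrt)
  have "((real k + ?s) / 2)\<^sup>2 - 1 = real k * ((real k + ?s) / 2)"
    using s(1) by (simp add: power2_eq_square field_simps)
  with s(2) show "(real k + ?s) / 2 \<in> derived_set (2 * k - 1) S_graph"
    using in_derived_set_S_graph[of "(real k + ?s) / 2" k 0] assms by simp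
  \<comment> \<open>With \<open>r = 1\<close> the equation reads
    \<open>(k + 1)\<^sup>2 - 1 = k * (k + 1) + k\<close>, and the extra arm at the root raises the
    index to \<open>2 * k\<close>.\<close>
  show "real k + 1 \<in> derived_set (2 * k) S_graph"
    using in_derived_set_S_graph[of "real k + 1" k 1] assms
    by (simp add: power2_eq_square algebra_simps)
qed

end
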